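(* Let $f$ be a partial computable function from $\mathbb{N}$ to $\mathbb{N}$, and for $x\in\mathbb{N}$ define $$q_f(x)=\liminf_{n\to\infty}\frac{\#\{i<n\mid f(i) \text{ is defined and } f(i)=x\}}{n}.$$ Then there exists a semimeasure $\mu$ on $\mathbb{N}$ that is lower semicomputable relative to the oracle $\mathbf{0}'$ such that $q_f(x)\le\mu(x)$ for all $x\in\mathbb{N}$.
   Context: A function $a:\mathbb{N}\to[0,\infty)$ is a semimeasure if $\sum_x a(x)\le 1$. It is lower semicomputable relative to an oracle $A$ if there is an $A$-computable total function $(x,s)\mapsto a(x,s)$ with rational values such that for each $x$ the sequence $a(x,0),a(x,1),\dots$ is nondecreasing with limit $a(x)$. $\mathbf{0}'$ denotes the halting problem (the universal computably enumerable set). In the definition of $q_f$, the denominator $n$ counts all $i<n$, including those where $f(i)$ is undefined. *)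

theory Defs
  imports Complex_Main "HOL-Library.Nat_Bijection" "HOL-Library.Extended_Real"
begin

text \<open>
  Kleene's partial recursive functions relative to an oracle, presented as unary functions on
  \<open>nat\<close>; several arguments are packed with the bijective pairing \<open>prod_encode\<close>.
\<close>

datatype prog =
    ZeroP
  | SuccP
  | FstP
  | SndP
  | OracleP
  | PairP prog prog
  | CompP prog prog
  | PrimRecP prog prog
  | MinP prog

primrec prog_eval :: "nat set \<Rightarrow> prog \<Rightarrow> nat \<Rightarrow> nat option" where
  "prog_eval A ZeroP = (\<lambda>n. Some 0)"
| "prog_eval A SuccP = (\<lambda>n. Some (Suc n))"
| "prog_eval A FstP = (\<lambda>n. Some (fst (prod_decode n)))"
| "prog_eval A SndP = (\<lambda>n. Some (snd (prod_decode n)))"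
| "prog_eval A OracleP = (\<lambda>n. Some (if n \<in> A then 1 else 0))"
| "prog_eval A (PairP p q) = (\<lambda>n. Option.bind (prog_eval A p n) (\<lambda>a.
     Option.bind (prog_eval A q n) (\<lambda>b. Some (prod_encode (a, b)))))"
| "prog_eval A (CompP p q) = (\<lambda>n. Option.bind (prog_eval A q n) (prog_eval A p))"
| "prog_eval A (PrimRecP p q) = (\<lambda>n. case prod_decode n of (a, k) \<Rightarrow>
     rec_nat (prog_eval A p a)
       (\<lambda>i r. Option.bind r (\<lambda>v. prog_eval A q (prod_encode (a, prod_encode (i, v))))) k)"
| "prog_eval A (MinP p) = (\<lambda>a.
     if \<exists>k. prog_eval A p (prod_encode (a, k)) = Some 0 \<and>
            (\<forall>j<k. prog_eval A p (prod_encode (a, j)) \<noteq> None)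
     then Some (LEAST k. prog_eval A p (prod_encode (a, k)) = Some 0)
     else None)"

definition partial_computable_in :: "nat set \<Rightarrow> (nat \<Rightarrow> nat option) \<Rightarrow> bool" where
  "partial_computable_in A f \<longleftrightarrow> (\<exists>p. f = prog_eval A p)"

abbreviation partial_computable :: "(nat \<Rightarrow> nat option) \<Rightarrow> bool" where
  "partial_computable \<equiv> partial_computable_in {}"

definition total_computable_in :: "nat set \<Rightarrow> (nat \<Rightarrow> nat) \<Rightarrow> bool" where
  "total_computable_in A h \<longleftrightarrow> partial_computable_in A (\<lambda>n. Some (h n))"

primrec prog_encode :: "prog \<Rightarrow> nat" where
  "prog_encode ZeroP = 0"
| "prog_encode SuccP = 1"
| "prog_encode FstP = 2"
| "prog_encode SndP = 3"
| "prog_encode OracleP = 4"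
| "prog_encode (PairP p q) = 5 + 4 * prod_encode (prog_encode p, prog_encode q)"
| "prog_encode (CompP p q) = 6 + 4 * prod_encode (prog_encode p, prog_encode q)"
| "prog_encode (PrimRecP p q) = 7 + 4 * prod_encode (prog_encode p, prog_encode q)"
| "prog_encode (MinP p) = 8 + 4 * prog_encode p"

lemma prog_encode_inject: "prog_encode p = prog_encode q \<Longrightarrow> p = q"
proof (induction p arbitrary: q)
  case (PairP p1 p2) then show ?case by (cases q; simp; presburger)
next
  case (CompP p1 p2) then show ?case by (cases q; simp; presburger)
next
  case (PrimRecP p1 p2) then show ?case by (cases q; simp; presburger)
next
  case (MinP p) then show ?case by (cases q; simp; presburger)
qed (case_tac q; simp)+

definition halting_problem :: "nat set" where
  "halting_problem = {prod_encode (prog_encode p, x) | p x. prog_eval {} p x \<noteq> None}"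

text \<open>A numbering of the rationals; every rational has infinitely many codes.\<close>

definition rat_decode :: "nat \<Rightarrow> rat" where
  "rat_decode n = (case prod_decode n of (a, b) \<Rightarrow> of_int (int_decode a) / of_nat (Suc b))"

lemma surj_rat_decode: "surj rat_decode"
proof (rule surjI)
  fix q :: rat
  obtain a b where q: "q = Fract a b" "b > 0" by (cases q) auto
  show "rat_decode (SOME n. rat_decode n = q) = q"
  proof (rule someI)
    show "rat_decode (prod_encode (int_encode a, nat (b - 1))) = q"
      using q by (simp add: rat_decode_def Fract_of_int_quotient)
  qed
qed

definition rat_computable_in :: "nat set \<Rightarrow> (nat \<Rightarrow> nat \<Rightarrow> rat) \<Rightarrow> bool" where
  "rat_computable_in A g \<longleftrightarrow>
     (\<exists>h. total_computable_in A h \<and> (\<forall>x s. g x s = rat_decode (h (prod_encode (x, s)))))"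

definition lower_semicomputable_in :: "nat set \<Rightarrow> (nat \<Rightarrow> real) \<Rightarrow> bool" where
  "lower_semicomputable_in A a \<longleftrightarrow>
     (\<exists>g. rat_computable_in A g \<and>
          (\<forall>x. mono (g x) \<and> (\<lambda>s. real_of_rat (g x s)) \<longlonglongrightarrow> a x))"

definition semimeasure :: "(nat \<Rightarrow> real) \<Rightarrow> bool" where
  "semimeasure a \<longleftrightarrow> (\<forall>x. 0 \<le> a x) \<and> summable a \<and> (\<Sum>x. a x) \<le> 1"

definition lower_frequency :: "(nat \<Rightarrow> nat option) \<Rightarrow> nat \<Rightarrow> ereal" where
  "lower_frequency f x =
     liminf (\<lambda>n. ereal (real (card {i. i < n \<and> f i = Some x}) / real n))"

end

theory Submission imports Defs begin

text \<open>
  Go through all requests \<open>(N, x, c)\<close>: ``raise the frequency of \<open>x\<close> among the first \<open>i\<close> values to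
  at least \<open>c\<close>, for every \<open>i \<ge> N\<close>''. A request is accepted if, together with the requests accepted
  before it, it does not push the total frequency above 1 at any index \<open>i\<close>. The observed frequencies
  of a partial computable \<open>f\<close> are lower semicomputable uniformly in \<open>i\<close>, so a violation is a halting
  event and the halting problem decides acceptance. Let \<open>\<mu> x\<close> be the supremum of the accepted \<open>c\<close>
  for \<open>x\<close>. Finitely many accepted requests are all active at large \<open>i\<close>, so \<open>\<mu>\<close> is a semimeasure. If
  \<open>c < q\<^sub>f x\<close>, then for large \<open>N\<close> the request \<open>(N, x, c)\<close> is satisfied already and changes nothing,
  so it is accepted.
\<close>

section \<open>Closure properties of total computable functions\<close>

definition decidable_in :: "nat set \<Rightarrow> (nat \<Rightarrow> bool) \<Rightarrow> bool" where
  "decidable_in A P \<longleftrightarrow> total_computable_in A (\<lambda>n. if P n then 1 else 0)"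

named_theorems computable_intros

lemma total_computable_inI:
  "(\<And>n. prog_eval A p n = Some (h n)) \<Longrightarrow> total_computable_in A h"
  unfolding total_computable_in_def partial_computable_in_def by (rule exI[of _ p]) auto

lemma total_computable_inE:
  assumes "total_computable_in A h"
  obtains p where "\<And>n. prog_eval A p n = Some (h n)"
  using assms unfolding total_computable_in_def partial_computable_in_def by metis

text \<open>There is no identity program; pairing the two projections again replaces it.\<close>

lemma computable_id [computable_intros]: "total_computable_in A (\<lambda>n. n)"
  by (rule total_computable_inI[of _ "PairP FstP SndP"]) simp

lemma computable_comp:
  assumes "total_computable_in A h" "total_computable_in A a"
  shows "total_computable_in A (\<lambda>n. h (a n))"
proof -
  obtain p q where "\<And>n. prog_eval A p n = Some (h n)" "\<And>n. prog_eval A q n = Some (a n)"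
    using assms by (metis total_computable_inE)
  then show ?thesis by (intro total_computable_inI[of _ "CompP p q"]) simp
qed

lemma computable_Suc [computable_intros]:
  "total_computable_in A a \<Longrightarrow> total_computable_in A (\<lambda>n. Suc (a n))"
  by (rule computable_comp[of A Suc]) (rule total_computable_inI[of _ SuccP], simp)

lemma computable_const [computable_intros]: "total_computable_in A (\<lambda>n. c)"
proof (induction c)
  case 0 show ?case by (rule total_computable_inI[of _ ZeroP]) simp
qed (rule computable_Suc)

lemma computable_fst [computable_intros]:
  "total_computable_in A a \<Longrightarrow> total_computable_in A (\<lambda>n. fst (prod_decode (a n)))"
  by (rule computable_comp[of A "\<lambda>n. fst (prod_decode n)"]) (rule total_computable_inI[of _ FstP], simp)

lemma computable_snd [computable_intros]:
  "total_computable_in A a \<Longrightarrow> total_computable_in A (\<lambda>n. snd (prod_decode (a n)))"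
  by (rule computable_comp[of A "\<lambda>n. snd (prod_decode n)"]) (rule total_computable_inI[of _ SndP], simp)

lemma computable_pair [computable_intros]:
  assumes "total_computable_in A a" "total_computable_in A b"
  shows "total_computable_in A (\<lambda>n. prod_encode (a n, b n))"
proof -
  obtain p q where "\<And>n. prog_eval A p n = Some (a n)" "\<And>n. prog_eval A q n = Some (b n)"
    using assms by (metis total_computable_inE)
  then show ?thesis by (intro total_computable_inI[of _ "PairP p q"]) simp
qed

text \<open>The tool for all bounded loops below: besides the counter and the value,
  \<open>Q\<close> takes \<open>n\<close> as a parameter, in the packing \<open>(n, (i, v))\<close>
  that \<open>PrimRecP\<close> uses.\<close>

lemma computable_rec_nat [computable_intros]:
  assumes F: "total_computable_in A F" and K: "total_computable_in A K"
    and Q: "total_computable_in A (\<lambda>m. Q (fst (prod_decode m))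
      (fst (prod_decode (snd (prod_decode m)))) (snd (prod_decode (snd (prod_decode m)))))"
  shows "total_computable_in A (\<lambda>n. rec_nat (F n) (Q n) (K n))"
proof -
  obtain p where p: "\<And>n. prog_eval A p n = Some (F n)" using F by (metis total_computable_inE)
  obtain q where q: "\<And>m. prog_eval A q m = Some (Q (fst (prod_decode m))
      (fst (prod_decode (snd (prod_decode m)))) (snd (prod_decode (snd (prod_decode m)))))"
    by (rule total_computable_inE[OF Q]) blast
  have "rec_nat (Some (F n)) (\<lambda>i r. Option.bind r (\<lambda>v. Some (Q n i v))) k = Some (rec_nat (F n) (Q n) k)"
    for n k by (induction k) auto
  then have "total_computable_in A (\<lambda>m. rec_nat (F (fst (prod_decode m))) (Q (fst (prod_decode m)))
      (snd (prod_decode m)))"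
    by (intro total_computable_inI[of _ "PrimRecP p q"]) (simp add: p q split: prod.split)
  from computable_comp[OF this computable_pair[OF computable_id K]] show ?thesis by simp
qed

section \<open>Arithmetic operations\<close>

lemma computable_add [computable_intros]:
  assumes "total_computable_in A a" "total_computable_in A b"
  shows "total_computable_in A (\<lambda>n. a n + b n)"
proof -
  have "m + k = rec_nat m (\<lambda>i v. Suc v) k" for m k by (induction k) auto
  then show ?thesis by (simp only:) (intro computable_intros assms)
qed

lemma computable_pred [computable_intros]:
  assumes "total_computable_in A a"
  shows "total_computable_in A (\<lambda>n. a n - Suc 0)"
proof -
  have "m - Suc 0 = rec_nat 0 (\<lambda>i v. i) m" for m by (cases m) auto
  then show ?thesis by (simp only:) (intro computable_intros assms)
qed

lemma computable_diff [computable_intros]: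
  assumes "total_computable_in A a" "total_computable_in A b"
  shows "total_computable_in A (\<lambda>n. a n - b n)"
proof -
  have "m - k = rec_nat m (\<lambda>i v. v - Suc 0) k" for m k :: nat by (induction k) auto
  \<comment> \<open>The instance for \<open>a\<close> and \<open>b\<close> keeps the rewriting below
    from looping, as the right side contains a subtraction itself.\<close>
  then have "a n - b n = rec_nat (a n) (\<lambda>i v. v - Suc 0) (b n)" for n .
  then show ?thesis by (simp only:) (intro computable_intros assms)
qed

lemma computable_sum [computable_intros]:
  assumes "total_computable_in A K"
    and "total_computable_in A (\<lambda>m. F (fst (prod_decode m)) (snd (prod_decode m)))"
  shows "total_computable_in A (\<lambda>n. \<Sum>j<K n. F n j)"
proof -
  have "(\<Sum>j<k. F n j) = rec_nat 0 (\<lambda>i v. v + F n i) k" for n k by (induction k) auto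
  moreover have "total_computable_in A (\<lambda>n. rec_nat 0 (\<lambda>i v. v + F n i) (K n))"
    using computable_comp[OF assms(2) computable_pair[OF computable_fst[OF computable_id]
      computable_fst[OF computable_snd[OF computable_id]]]]
    by (intro computable_intros assms(1)) simp
  ultimately show ?thesis by simp
qed

lemma computable_mult [computable_intros]:
  assumes "total_computable_in A a" "total_computable_in A b"
  shows "total_computable_in A (\<lambda>n. a n * b n)"
proof -
  have "m * k = (\<Sum>j<k. m)" for m k :: nat by simp
  then show ?thesis by (simp only:) (intro computable_intros assms computable_comp[OF assms(1)])
qed

lemma computable_power2 [computable_intros]:
  assumes "total_computable_in A a"
  shows "total_computable_in A (\<lambda>n. 2 ^ a n)"
proof -
  have "(2::nat) ^ k = rec_nat 1 (\<lambda>i v. v + v) k" for k :: nat by (induction k) auto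
  then show ?thesis by (simp only:) (intro computable_intros assms)
qed

section \<open>Case distinctions, decidable relations and division\<close>

lemma computable_if [computable_intros]:
  assumes "decidable_in A P" "total_computable_in A a" "total_computable_in A b"
  shows "total_computable_in A (\<lambda>n. if P n then a n else b n)"
proof -
  have "(if P n then a n else b n) =
      (if P n then 1 else 0) * a n + (1 - (if P n then 1 else 0)) * b n" for n by simp
  then show ?thesis
    by (simp only:) (intro computable_intros assms assms(1)[unfolded decidable_in_def])
qed

lemma decidable_le [computable_intros]:
  assumes "total_computable_in A a" "total_computable_in A b"
  shows "decidable_in A (\<lambda>n. a n \<le> b n)"
proof -
  have "(if a n \<le> b n then 1 else 0) = 1 - (a n - b n)" for n by simp
  then show ?thesis unfolding decidable_in_def by (simp only:) (intro computable_intros assms)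
qed

lemma decidable_conj [computable_intros]:
  assumes "decidable_in A P" "decidable_in A Q"
  shows "decidable_in A (\<lambda>n. P n \<and> Q n)"
proof -
  have "(if P n \<and> Q n then 1 else 0) = (if P n then if Q n then 1 else 0 else (0::nat))" for n by simp
  then show ?thesis unfolding decidable_in_def by (simp only:) (intro computable_intros assms)
qed

lemma decidable_not [computable_intros]:
  assumes "decidable_in A P"
  shows "decidable_in A (\<lambda>n. \<not> P n)"
proof -
  have "(if \<not> P n then 1 else 0) = (if P n then 0 else (1::nat))" for n by simp
  then show ?thesis unfolding decidable_in_def by (simp only:) (intro computable_intros assms)
qed

lemma decidable_eq [computable_intros]:
  assumes "total_computable_in A a" "total_computable_in A b"
  shows "decidable_in A (\<lambda>n. a n = b n)"
  unfolding eq_iff[where 'a = nat] by (intro computable_intros assms)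

lemma computable_max [computable_intros]:
  assumes "total_computable_in A a" "total_computable_in A b"
  shows "total_computable_in A (\<lambda>n. max (a n) (b n))"
  unfolding max_def by (intro computable_intros assms)

lemma computable_div [computable_intros]:
  assumes "total_computable_in A a" "total_computable_in A b"
  shows "total_computable_in A (\<lambda>n. a n div b n)"
proof -
  \<comment> \<open>For \<open>k > 0\<close> the quotient counts the \<open>j < m\<close> with
    \<open>(j + 1) * k <= m\<close>; the case \<open>k = 0\<close> follows the convention
    \<open>m div 0 = 0\<close>.\<close>
  have "m div k = (if k = 0 then 0 else \<Sum>j<m. if Suc j * k \<le> m then 1 else 0)" for m k :: nat
  proof (cases "k = 0")
    case False
    then have "j < m \<and> Suc j * k \<le> m \<longleftrightarrow> j < m div k" for j
      using div_le_dividend[of m k] less_eq_div_iff_mult_less_eq[of k "Suc j" m] by linarith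
    then have "{j. j < m \<and> Suc j * k \<le> m} = {..<m div k}" by auto
    then show ?thesis using False
      by (simp add: sum.If_cases Int_def del: mult_Suc)
  qed simp
  then show ?thesis
    by (simp only:) (intro computable_intros assms computable_comp[OF assms(1)] computable_comp[OF assms(2)])
qed

text \<open>\<open>set_decode\<close> reads the binary digits of a number, and a digit is the parity
  of a quotient by a power of two.\<close>

lemma decidable_mem_set_decode [computable_intros]:
  assumes "total_computable_in A a" "total_computable_in A b"
  shows "decidable_in A (\<lambda>n. a n \<in> set_decode (b n))"
proof -
  have "a n \<in> set_decode (b n) \<longleftrightarrow> \<not> b n div 2 ^ a n = 2 * (b n div 2 ^ a n div 2)" for n
    unfolding set_decode_def by (auto intro: dvdI)
  then show ?thesis by (simp only:) (intro computable_intros assms)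
qed

section \<open>Step-bounded evaluation\<close>

text \<open>The value is shifted by one; 0 means that no result was found within the bound \<open>t\<close> on all
  unbounded searches. In the search, state 0 means ``still looking'' and state 1 means that an
  undefined value was met.\<close>

primrec step_eval :: "nat \<Rightarrow> prog \<Rightarrow> nat \<Rightarrow> nat" where
  "step_eval t ZeroP = (\<lambda>n. Suc 0)"
| "step_eval t SuccP = (\<lambda>n. Suc (Suc n))"
| "step_eval t FstP = (\<lambda>n. Suc (fst (prod_decode n)))"
| "step_eval t SndP = (\<lambda>n. Suc (snd (prod_decode n)))"
| "step_eval t OracleP = (\<lambda>n. Suc 0)"
| "step_eval t (PairP p q) = (\<lambda>n. if step_eval t p n = 0 then 0 else if step_eval t q n = 0 then 0
     else Suc (prod_encode (step_eval t p n - Suc 0, step_eval t q n - Suc 0)))"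
| "step_eval t (CompP p q) = (\<lambda>n. if step_eval t q n = 0 then 0
     else step_eval t p (step_eval t q n - Suc 0))"
| "step_eval t (PrimRecP p q) = (\<lambda>n. rec_nat (step_eval t p (fst (prod_decode n)))
     (\<lambda>i r. if r = 0 then 0
        else step_eval t q (prod_encode (fst (prod_decode n), prod_encode (i, r - Suc 0))))
     (snd (prod_decode n)))"
| "step_eval t (MinP p) = (\<lambda>n. rec_nat 0
     (\<lambda>k r. if r = 0 then if step_eval t p (prod_encode (n, k)) = 0 then 1
        else if step_eval t p (prod_encode (n, k)) = 1 then Suc (Suc k) else 0 else r) t - Suc 0)"

text \<open>The program is fixed, so structural induction on it suffices; \<open>t\<close> and
  \<open>a\<close> vary because subprograms run on other arguments.\<close>

lemma computable_step_eval [computable_intros]: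
  assumes "total_computable_in A t" "total_computable_in A a"
  shows "total_computable_in A (\<lambda>n. step_eval (t n) p (a n))"
  using assms
proof (induction p arbitrary: t a)
  case (PairP p q)
  show ?case unfolding step_eval.simps
    by (intro computable_intros PairP.IH PairP.prems)
next
  case (CompP p q)
  show ?case unfolding step_eval.simps
    by (intro computable_intros CompP.IH CompP.prems)
next
  case (PrimRecP p q)
  show ?case unfolding step_eval.simps
    by (intro computable_intros PrimRecP.IH PrimRecP.prems computable_comp[OF PrimRecP.prems(1)]
        computable_comp[OF PrimRecP.prems(2)])
next
  case (MinP p)
  show ?case unfolding step_eval.simps
    by (intro computable_intros MinP.IH MinP.prems computable_comp[OF MinP.prems(1)]
        computable_comp[OF MinP.prems(2)])
qed (simp only: step_eval.simps, intro computable_intros, assumption?)+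

text \<open>A state \<open>Suc (Suc k)\<close> records the hit \<open>k\<close>. With values shifted
  by one, \<open>g k = 1\<close> means the value 0 and \<open>1 < g j\<close> a nonzero value, so
  this is the defining condition of \<open>MinP\<close> cut off at \<open>t\<close>.\<close>

lemma rec_search_eq_iff:
  fixes g :: "nat \<Rightarrow> nat"
  shows "rec_nat 0 (\<lambda>k r. if r = 0 then if g k = 0 then 1 else if g k = 1 then Suc (Suc k) else 0
     else r) t = Suc (Suc k) \<longleftrightarrow> k < t \<and> g k = 1 \<and> (\<forall>j<k. 1 < g j)"
  (is "?s t = _ \<longleftrightarrow> _")
proof -
  have none: "?s t = 0 \<longleftrightarrow> (\<forall>j<t. 1 < g j)" for t
    by (induction t) (auto simp: less_Suc_eq)
  show ?thesis
  proof (induction t)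
    case (Suc t)
    show ?case
    proof (cases "?s t = 0")
      case True
      then show ?thesis using none[of t] by (auto simp: less_Suc_eq)
    next
      case False
      then show ?thesis using none[of t] Suc by (auto simp: less_Suc_eq)
    qed
  qed simp
qed

text \<open>The bounded search gives up at the first value not found instead of skipping it, so a
  hit is the true least zero. The oracle is empty, which matches the constant answer to
  \<open>OracleP\<close>.\<close>

lemma step_eval_sound: "step_eval t p n = Suc v \<Longrightarrow> prog_eval {} p n = Some v"
proof (induction p arbitrary: n v)
  case (PairP p q)
  then show ?case by (cases "step_eval t p n"; cases "step_eval t q n") auto
next
  case (CompP p q)
  then show ?case by (cases "step_eval t q n") auto
next
  case (PrimRecP p q)
  obtain a k where n: "n = prod_encode (a, k)" by (metis prod_decode_inverse surj_pair)
  let ?S = "rec_nat (step_eval t p a) (\<lambda>i r. if r = 0 then 0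
        else step_eval t q (prod_encode (a, prod_encode (i, r - Suc 0))))"
  have "?S k = Suc v \<Longrightarrow> prog_eval {} (PrimRecP p q) (prod_encode (a, k)) = Some v" for k v
  proof (induction k arbitrary: v)
    case 0
    then show ?case using PrimRecP.IH(1) by simp
  next
    case (Suc k)
    then show ?case using PrimRecP.IH(2) by (cases "?S k") auto
  qed
  with PrimRecP.prems show ?case by (simp add: n cong: if_cong)
next
  case (MinP p)
  let ?g = "\<lambda>k. step_eval t p (prod_encode (n, k))"
  \<comment> \<open>The final subtraction in \<open>step_eval\<close> turns both states 0 and 1 into
    failure, so a result \<open>Suc v\<close> comes from the state
    \<open>Suc (Suc v)\<close>.\<close>
  have g: "?g v = 1" "\<forall>j<v. 1 < ?g j"
    using MinP.prems rec_search_eq_iff[of ?g t v] by auto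
  have v: "prog_eval {} p (prod_encode (n, v)) = Some 0" using g(1) MinP.IH by simp
  have j: "\<exists>w>0. prog_eval {} p (prod_encode (n, j)) = Some w" if "j < v" for j
    using g(2) that MinP.IH[of "prod_encode (n, j)" "?g j - 1"]
    by (intro exI[of _ "?g j - 1"]) auto
  have "(LEAST k. prog_eval {} p (prod_encode (n, k)) = Some 0) = v"
    using v j by (intro Least_equality) (auto simp: not_less[symmetric], fastforce)
  then show ?case using v j by fastforce
qed auto

text \<open>A converging computation has finitely many subcomputations, each settled for all large
  \<open>t\<close>, and finitely many eventual facts eventually hold together.\<close>

lemma step_eval_complete:
  "prog_eval {} p n = Some v \<Longrightarrow> \<forall>\<^sub>F t in sequentially. step_eval t p n = Suc v"
proof (induction p arbitrary: n v)
  case (PairP p q)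
  from PairP.prems obtain a b where ab: "prog_eval {} p n = Some a" "prog_eval {} q n = Some b"
      "v = prod_encode (a, b)"
    by (auto simp: bind_eq_Some_conv)
  from PairP.IH(1)[OF ab(1)] PairP.IH(2)[OF ab(2)] show ?case
    by eventually_elim (simp add: ab)
next
  case (CompP p q)
  from CompP.prems obtain b where b: "prog_eval {} q n = Some b" "prog_eval {} p b = Some v"
    by (auto simp: bind_eq_Some_conv)
  from CompP.IH(1)[OF b(2)] CompP.IH(2)[OF b(1)] show ?case
    by eventually_elim simp
next
  case (PrimRecP p q)
  obtain a k where n: "n = prod_encode (a, k)" by (metis prod_decode_inverse surj_pair)
  have "prog_eval {} (PrimRecP p q) (prod_encode (a, k)) = Some v \<Longrightarrow>
    \<forall>\<^sub>F t in sequentially. step_eval t (PrimRecP p q) (prod_encode (a, k)) = Suc v" for k v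
  proof (induction k arbitrary: v)
    case 0
    then show ?case using PrimRecP.IH(1) by simp
  next
    case (Suc k)
    then obtain w where w: "prog_eval {} (PrimRecP p q) (prod_encode (a, k)) = Some w"
        "prog_eval {} q (prod_encode (a, prod_encode (k, w))) = Some v"
      by (auto simp: bind_eq_Some_conv)
    from Suc.IH[OF w(1)] PrimRecP.IH(2)[OF w(2)] show ?case
      by eventually_elim (simp cong: if_cong)
  qed
  with PrimRecP.prems show ?case by (simp add: n cong: if_cong)
next
  case (MinP p)
  let ?P = "\<lambda>k. prog_eval {} p (prod_encode (n, k))"
  \<comment> \<open>This zero \<open>k\<close> may not be the least one; but \<open>v <= k\<close>,
    so below \<open>v\<close> every value is defined and nonzero.\<close>
  from MinP.prems obtain k where k: "?P k = Some 0" "\<And>j. j < k \<Longrightarrow> ?P j \<noteq> None"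
    and v: "v = (LEAST k. ?P k = Some 0)"
    by (auto split: if_splits)
  have Pv: "?P v = Some 0" unfolding v using k(1) by (rule LeastI)
  have "v \<le> k" unfolding v using k(1) by (rule Least_le)
  have Pj: "\<exists>w. ?P j = Some (Suc w)" if "j < v" for j
  proof -
    have "?P j \<noteq> Some 0" using that unfolding v by (rule not_less_Least)
    then show ?thesis using k(2)[of j] that \<open>v \<le> k\<close> by (cases "?P j") (auto simp: gr0_conv_Suc)
  qed
  have ev: "\<forall>\<^sub>F t in sequentially. \<forall>j\<in>{..<v}. 1 < step_eval t p (prod_encode (n, j))"
  proof (intro eventually_ball_finite ballI)
    fix j assume "j \<in> {..<v}"
    then obtain w where "?P j = Some (Suc w)" using Pj by auto
    from MinP.IH[OF this] show "\<forall>\<^sub>F t in sequentially. 1 < step_eval t p (prod_encode (n, j))"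
      by eventually_elim simp
  qed simp
  \<comment> \<open>The bound \<open>t\<close> must also exceed \<open>v\<close> for the search to
    reach \<open>v\<close>.\<close>
  from MinP.IH[OF Pv] ev eventually_gt_at_top[of v] show ?case
  proof eventually_elim
    case (elim t)
    then have "rec_nat 0 (\<lambda>k r. if r = 0 then if step_eval t p (prod_encode (n, k)) = 0 then 1
        else if step_eval t p (prod_encode (n, k)) = 1 then Suc (Suc k) else 0 else r) t = Suc (Suc v)"
      by (subst rec_search_eq_iff) auto
    then show ?case by simp
  qed
qed auto

section \<open>Deciding searches with the halting problem\<close>

text \<open>\<open>MinP\<close> looks for a zero, so truth is coded by 0 in the proof. As the tested
  predicate is total, the search halts exactly when a witness exists, and one oracle query on a
  fixed program code decides this.\<close>

lemma decidable_halting_search: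
  assumes "decidable_in {} (\<lambda>m. P (fst (prod_decode m)) (snd (prod_decode m)))"
  shows "decidable_in halting_problem (\<lambda>n. \<exists>k. P n k)"
proof -
  have tc: "total_computable_in {} (\<lambda>m. if P (fst (prod_decode m)) (snd (prod_decode m)) then 0 else 1)"
    by (intro computable_intros assms)
  obtain p where p: "\<And>m. prog_eval {} p m =
      Some (if P (fst (prod_decode m)) (snd (prod_decode m)) then 0 else 1)"
    by (rule total_computable_inE[OF tc]) blast
  have "prod_encode (prog_encode (MinP p), n) \<in> halting_problem \<longleftrightarrow> prog_eval {} (MinP p) n \<noteq> None" for n
    unfolding halting_problem_def
    by (auto dest: prog_encode_inject simp del: prog_encode.simps prog_eval.simps)
  moreover have "prog_eval {} (MinP p) n \<noteq> None \<longleftrightarrow> (\<exists>k. P n k)" for n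
    by (simp add: p)
  ultimately have iff: "(\<exists>k. P n k) \<longleftrightarrow> prod_encode (prog_encode (MinP p), n) \<in> halting_problem" for n
    by blast
  have "total_computable_in halting_problem (\<lambda>n. if n \<in> halting_problem then 1 else 0)"
    by (rule total_computable_inI[of _ OracleP]) simp
  from computable_comp[OF this computable_pair[OF computable_const computable_id]]
  show ?thesis unfolding decidable_in_def iff .
qed

section \<open>Greedy acceptance of requests\<close>

text \<open>Every number codes a request \<open>(N, x, c)\<close>. Rounding its demand \<open>c * i\<close> down to an integer keeps
  the acceptance test in \<open>nat\<close>; the rounding error disappears in the limit.\<close>

definition request_start :: "nat \<Rightarrow> nat" where
  "request_start s = fst (prod_decode s)"

definition request_point :: "nat \<Rightarrow> nat" where
  "request_point s = fst (prod_decode (snd (prod_decode s)))"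

definition request_value :: "nat \<Rightarrow> nat" where
  "request_value s = snd (prod_decode (snd (prod_decode s)))"

definition fraction :: "nat \<Rightarrow> rat" where
  "fraction c = of_nat (fst (prod_decode c)) / of_nat (Suc (snd (prod_decode c)))"

definition demand :: "nat \<Rightarrow> nat \<Rightarrow> nat \<Rightarrow> nat" where
  "demand s i x = (if request_point s = x \<and> request_start s \<le> i
     then fst (prod_decode (request_value s)) * i div Suc (snd (prod_decode (request_value s))) else 0)"

definition level :: "nat set \<Rightarrow> nat \<Rightarrow> nat \<Rightarrow> nat" where
  "level S i x = Max (insert 0 ((\<lambda>s. demand s i x) ` S))"

definition occurrences :: "(nat \<Rightarrow> nat option) \<Rightarrow> nat \<Rightarrow> nat \<Rightarrow> nat" where
  "occurrences f i x = card {j. j < i \<and> f j = Some x}"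

text \<open>Bounding all partial sums replaces an infinite sum, so a violation has a finite
  witness.\<close>

definition consistent :: "(nat \<Rightarrow> nat option) \<Rightarrow> nat set \<Rightarrow> bool" where
  "consistent f S \<longleftrightarrow> (\<forall>i B. (\<Sum>x<B. max (occurrences f i x) (level S i x)) \<le> i)"

primrec accepted :: "(nat \<Rightarrow> nat option) \<Rightarrow> nat \<Rightarrow> nat set" where
  "accepted f 0 = {}"
| "accepted f (Suc s) =
     (if consistent f (insert s (accepted f s)) then insert s (accepted f s) else accepted f s)"

text \<open>Codes are kept instead of rationals and compared by cross-multiplication, to stay within
  \<open>nat\<close>; the initial code 0 denotes the fraction 0. Request \<open>s\<close> is decided
  at stage \<open>Suc s\<close>.\<close>

primrec best_value :: "(nat \<Rightarrow> nat option) \<Rightarrow> nat \<Rightarrow> nat \<Rightarrow> nat" where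
  "best_value f x 0 = 0"
| "best_value f x (Suc s) =
     (if s \<in> accepted f (Suc s) \<and> request_point s = x \<and>
         fst (prod_decode (best_value f x s)) * Suc (snd (prod_decode (request_value s)))
           \<le> fst (prod_decode (request_value s)) * Suc (snd (prod_decode (best_value f x s)))
      then request_value s else best_value f x s)"

section \<open>Comparison of fractions and monotonicity in the stage\<close>

lemma fraction_nonneg: "0 \<le> fraction c"
  by (simp add: fraction_def)

lemma fraction_0: "fraction 0 = 0"
  by (simp add: fraction_def prod_decode_def prod_decode_aux.simps)

lemma fraction_le_iff:
  "fraction c \<le> fraction d \<longleftrightarrow> fst (prod_decode c) * Suc (snd (prod_decode d))
     \<le> fst (prod_decode d) * Suc (snd (prod_decode c))"
  unfolding fraction_def of_nat_le_iff[where 'a = rat, symmetric] of_nat_mult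
  by (simp add: divide_le_eq pos_le_divide_eq ac_simps del: of_nat_Suc)

lemma fraction_best_value_Suc:
  "fraction (best_value f x (Suc s)) =
     (if s \<in> accepted f (Suc s) \<and> request_point s = x
      then max (fraction (best_value f x s)) (fraction (request_value s))
      else fraction (best_value f x s))"
  using fraction_le_iff[of "best_value f x s" "request_value s"] by (simp del: accepted.simps add: max_def)

lemma mono_fraction_best_value: "mono (\<lambda>s. fraction (best_value f x s))"
  unfolding mono_iff_le_Suc by (simp del: best_value.simps add: fraction_best_value_Suc)

lemma accepted_subset: "accepted f s \<subseteq> {..<s}"
  by (induction s) auto

lemma finite_accepted: "finite (accepted f s)"
  using accepted_subset finite_subset by blast

lemma mono_accepted: "s \<le> s' \<Longrightarrow> accepted f s \<subseteq> accepted f s'"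
  by (rule lift_Suc_mono_le) auto

text \<open>Ties each nonzero value to one accepted request, whose demand can then be compared with
  the level.\<close>

lemma best_value_cases:
  "fraction (best_value f x s) = 0 \<or> (\<exists>r\<in>accepted f s. request_point r = x \<and>
     fraction (best_value f x s) = fraction (request_value r))"
proof (induction s)
  case 0
  show ?case by (simp add: fraction_0)
next
  case (Suc s)
  have "accepted f s \<subseteq> accepted f (Suc s)" by (rule mono_accepted) simp
  with Suc show ?case
    unfolding fraction_best_value_Suc by (auto simp: max_def simp del: accepted.simps)
qed

section \<open>Consistency of the accepted requests and the bound on the total mass\<close>

lemma sum_occurrences_le: "(\<Sum>x<B. occurrences f i x) \<le> i"
proof -
  have "(\<Sum>x<B. occurrences f i x) = card (\<Union>x<B. {j. j < i \<and> f j = Some x})"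
    unfolding occurrences_def by (subst card_UN_disjoint) auto
  also have "\<dots> \<le> card {..<i}" by (intro card_mono) auto
  finally show ?thesis by simp
qed

text \<open>Without requests only the observed counts matter, and they total at most
  \<open>i\<close>; later stages pass the test explicitly.\<close>

lemma consistent_accepted: "consistent f (accepted f s)"
proof (induction s)
  case 0
  show ?case using sum_occurrences_le by (simp add: consistent_def level_def)
qed simp

lemma level_insert: "finite S \<Longrightarrow> level (insert s S) i x = max (demand s i x) (level S i x)"
  unfolding level_def image_insert insert_commute[of 0] by (rule Max_insert) auto

lemma demand_le_level: "finite S \<Longrightarrow> s \<in> S \<Longrightarrow> demand s i x \<le> level S i x"
  by (simp add: level_def)

lemma real_of_rat_fraction:
  "real_of_rat (fraction c) = real (fst (prod_decode c)) / real (Suc (snd (prod_decode c)))"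
  by (simp add: fraction_def of_rat_divide del: of_nat_Suc)

text \<open>Rounding the demand down costs less than 1, uniformly in \<open>i\<close>.\<close>

lemma demand_ge:
  assumes "request_start s \<le> i"
  shows "real_of_rat (fraction (request_value s)) * real i - 1 \<le> demand s i (request_point s)"
proof -
  have "real a / real b - 1 \<le> real (a div b)" for a b :: nat
    using floor_divide_of_nat_eq[of a b, where 'a = real] by linarith
  from this[of "fst (prod_decode (request_value s)) * i" "Suc (snd (prod_decode (request_value s)))"]
  show ?thesis using assms by (simp add: demand_def real_of_rat_fraction)
qed

text \<open>Once \<open>i\<close> is past all start indices, consistency gives
  \<open>i * sum - B <= i\<close>, with one unit of rounding per point. So the excess of the sum
  over 1 is at most \<open>B / i\<close>, which tends to 0.\<close>

lemma sum_best_value_le_1: "(\<Sum>x<B. real_of_rat (fraction (best_value f x s))) \<le> 1"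
proof (rule ccontr)
  let ?g = "\<lambda>x. real_of_rat (fraction (best_value f x s))"
  assume "\<not> ?thesis"
  then have pos: "0 < (\<Sum>x<B. ?g x) - 1" by simp
  then obtain M where M: "real B < real M * ((\<Sum>x<B. ?g x) - 1)"
    using reals_Archimedean3 by blast
  \<comment> \<open>The sum of the starts bounds each of them, so every accepted request is active
    at \<open>i\<close>; the summand \<open>M\<close> makes \<open>i\<close> times the excess larger
    than \<open>B\<close>.\<close>
  define i where "i = M + (\<Sum>r\<in>accepted f s. request_start r)"
  have start: "request_start r \<le> i" if "r \<in> accepted f s" for r
    using member_le_sum[OF that, of request_start] finite_accepted by (simp add: i_def trans_le_add2)
  have "?g x * i - 1 \<le> level (accepted f s) i x" for x
    using best_value_cases[of f x s]
  proof
    assume "\<exists>r\<in>accepted f s. request_point r = x \<and>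
      fraction (best_value f x s) = fraction (request_value r)"
    then obtain r where r: "r \<in> accepted f s" "request_point r = x"
      "fraction (best_value f x s) = fraction (request_value r)" by blast
    have "?g x * i - 1 \<le> real (demand r i x)" using demand_ge[OF start[OF r(1)]] r by simp
    also have "\<dots> \<le> level (accepted f s) i x" using demand_le_level[OF finite_accepted r(1)] by simp
    finally show ?thesis .
  qed simp
  then have "?g x * i - 1 \<le> real (max (occurrences f i x) (level (accepted f s) i x))" for x
    by (rule order.trans) simp
  then have "(\<Sum>x<B. ?g x * i - 1) \<le> (\<Sum>x<B. real (max (occurrences f i x) (level (accepted f s) i x)))"
    by (intro sum_mono)
  also have "\<dots> \<le> real i"
    using consistent_accepted[of f s] unfolding consistent_def of_nat_sum[symmetric] of_nat_le_iff by blast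
  finally have "real i * ((\<Sum>x<B. ?g x) - 1) \<le> real B"
    by (simp add: sum_subtractf sum_distrib_left algebra_simps)
  moreover have "real M * ((\<Sum>x<B. ?g x) - 1) \<le> real i * ((\<Sum>x<B. ?g x) - 1)"
    using pos by (intro mult_right_mono) (simp_all add: i_def sum_nonneg)
  ultimately show False using M by linarith
qed

text \<open>The demand of \<open>s\<close> never exceeds the observed count, so every
  \<open>max\<close> in the test keeps its value.\<close>

lemma consistent_insert_satisfied:
  assumes "consistent f S" "finite S"
    and "\<And>i. request_start s \<le> i \<Longrightarrow>
      real_of_rat (fraction (request_value s)) * real i \<le> real (occurrences f i (request_point s))"
  shows "consistent f (insert s S)"
proof -
  have "demand s i x \<le> occurrences f i x" for i x
  proof (cases "request_point s = x \<and> request_start s \<le> i")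
    case True
    let ?a = "fst (prod_decode (request_value s)) * i" and ?b = "Suc (snd (prod_decode (request_value s)))"
    have "real (?a div ?b) \<le> real ?a / real ?b" by (rule of_nat_div_le_of_nat)
    also have "\<dots> \<le> real (occurrences f i x)"
      using assms(3)[of i] True by (simp add: real_of_rat_fraction)
    finally show ?thesis using True by (simp add: demand_def)
  qed (auto simp: demand_def)
  then have "max (occurrences f i x) (level (insert s S) i x) = max (occurrences f i x) (level S i x)" for i x
    using level_insert[OF assms(2), of s i x] by (simp add: max.left_commute max.absorb2 flip: max.assoc)
  then show ?thesis using assms(1) by (simp add: consistent_def)
qed

section \<open>Computability of the construction\<close>

text \<open>Turns the maximum over a coded set into a primitive recursion. The code itself bounds
  the loop: a member \<open>s\<close> gives \<open>2 ^ s <= T\<close>, hence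
  \<open>s < T\<close>.\<close>

lemma level_set_decode:
  "level (set_decode T) i x =
     rec_nat 0 (\<lambda>s v. max v (if s \<in> set_decode T then demand s i x else 0)) T"
proof -
  have "rec_nat 0 (\<lambda>s v. max v (if s \<in> S then d s else 0)) n = Max (insert 0 (d ` (S \<inter> {..<n})))"
    for S and d :: "nat \<Rightarrow> nat" and n
  proof (induction n)
    case (Suc n)
    have "S \<inter> {..<Suc n} = (if n \<in> S then insert n (S \<inter> {..<n}) else S \<inter> {..<n})"
      by (auto simp: less_Suc_eq)
    moreover have "Max (insert 0 (insert a X)) = max (Max (insert 0 X)) a" if "finite X" for a :: nat and X
      using that by (subst insert_commute, subst Max_insert) (auto simp: max.commute)
    ultimately show ?case using Suc by (simp del: Max_insert)
  qed simp
  moreover have "s < T" if "s \<in> set_decode T" for s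
  proof -
    have "T div 2 ^ s \<noteq> 0" using that by (auto simp: set_decode_def intro: ccontr)
    then have "2 ^ s \<le> T" by (simp add: div_eq_0_iff)
    then show ?thesis using less_exp[of s] by linarith
  qed
  then have "set_decode T \<inter> {..<T} = set_decode T" by auto
  ultimately show ?thesis by (simp add: level_def)
qed

lemma computable_level [computable_intros]:
  assumes "total_computable_in A T" "total_computable_in A i" "total_computable_in A x"
  shows "total_computable_in A (\<lambda>n. level (set_decode (T n)) (i n) (x n))"
  unfolding level_set_decode demand_def request_start_def request_point_def request_value_def
  by (intro computable_intros assms assms[THEN computable_comp])

text \<open>Makes inconsistency a search for numbers with a decidable property. Bounded evaluation
  never overcounts, and for large \<open>t\<close> it is exact on the finitely many inputs below
  \<open>i\<close>.\<close>

lemma not_consistent_iff: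
  "\<not> consistent (prog_eval {} p) S \<longleftrightarrow>
     (\<exists>i t B. \<not> (\<Sum>x<B. max (\<Sum>j<i. if step_eval t p j = Suc x then 1 else 0) (level S i x)) \<le> i)"
  (is "_ \<longleftrightarrow> (\<exists>i t B. \<not> ?s i t B \<le> i)")
proof
  have count: "(\<Sum>j<i. if P j then 1 else 0) = card {j. j < i \<and> P j}" for i :: nat and P
    by (simp add: sum.If_cases Int_def)
  {
    assume "\<not> consistent (prog_eval {} p) S"
    then obtain i B where iB:
      "\<not> (\<Sum>x<B. max (occurrences (prog_eval {} p) i x) (level S i x)) \<le> i"
      unfolding consistent_def by blast
    have "\<forall>\<^sub>F t in sequentially. \<forall>j\<in>{..<i}. \<forall>x. prog_eval {} p j = Some x \<longrightarrow> step_eval t p j = Suc x"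
    proof (intro eventually_ball_finite ballI)
      fix j
      show "\<forall>\<^sub>F t in sequentially. \<forall>x. prog_eval {} p j = Some x \<longrightarrow> step_eval t p j = Suc x"
        using step_eval_complete[of p j] by (cases "prog_eval {} p j") auto
    qed simp
    then obtain t where "\<forall>j<i. \<forall>x. prog_eval {} p j = Some x \<longrightarrow> step_eval t p j = Suc x"
      using eventually_happens by fastforce
    then have "occurrences (prog_eval {} p) i x = (\<Sum>j<i. if step_eval t p j = Suc x then 1 else 0)" for x
      unfolding occurrences_def count using step_eval_sound by (intro arg_cong[of _ _ card]) blast
    with iB have "\<not> ?s i t B \<le> i" by simp
    then show "\<exists>i t B. \<not> ?s i t B \<le> i" by blast
  next
    assume "\<exists>i t B. \<not> ?s i t B \<le> i"
    then obtain i t B where "\<not> ?s i t B \<le> i" by blast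
    moreover have "(\<Sum>j<i. if step_eval t p j = Suc x then 1 else 0) \<le> occurrences (prog_eval {} p) i x" for x
      unfolding occurrences_def count using step_eval_sound by (intro card_mono) auto
    then have "?s i t B \<le> (\<Sum>x<B. max (occurrences (prog_eval {} p) i x) (level S i x))"
      by (intro sum_mono max.mono) auto
    ultimately have "\<not> (\<Sum>x<B. max (occurrences (prog_eval {} p) i x) (level S i x)) \<le> i" by linarith
    then show "\<not> consistent (prog_eval {} p) S" unfolding consistent_def by blast
  }
qed

lemma decidable_consistent:
  "decidable_in halting_problem (\<lambda>T. consistent (prog_eval {} p) (set_decode T))"
proof -
  let ?P = "\<lambda>T w. \<not> (\<Sum>x<snd (prod_decode (snd (prod_decode w))).
      max (\<Sum>j<fst (prod_decode w).
             if step_eval (fst (prod_decode (snd (prod_decode w)))) p j = Suc x then 1 else 0)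
        (level (set_decode T) (fst (prod_decode w)) x)) \<le> fst (prod_decode w)"
  have "decidable_in {} (\<lambda>m. ?P (fst (prod_decode m)) (snd (prod_decode m)))"
    by (intro computable_intros)
  then have dec: "decidable_in halting_problem (\<lambda>T. \<not> (\<exists>w. ?P T w))"
    by (rule decidable_not[OF decidable_halting_search[where P = ?P]])
  \<comment> \<open>The three numbers searched for are packed into one as
    \<open>(i, (t, B))\<close>.\<close>
  have triple: "(\<exists>i t B. Q i t B) \<longleftrightarrow> (\<exists>w. Q (fst (prod_decode w))
      (fst (prod_decode (snd (prod_decode w)))) (snd (prod_decode (snd (prod_decode w)))))" for Q
    by (metis fst_conv snd_conv prod_encode_inverse)
  have "\<not> consistent (prog_eval {} p) (set_decode T) \<longleftrightarrow> (\<exists>w. ?P T w)" for T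
    unfolding not_consistent_iff by (rule triple)
  from dec[folded this] show ?thesis unfolding not_not .
qed

text \<open>The set is carried through the recursion as a binary code; all members at stage
  \<open>s\<close> lie below \<open>s\<close>, so inserting \<open>s\<close> adds exactly
  \<open>2 ^ s\<close>.\<close>

lemma computable_set_encode_accepted:
  "total_computable_in halting_problem (\<lambda>s. set_encode (accepted (prog_eval {} p) s))"
proof -
  let ?f = "prog_eval {} p"
  have "set_encode (accepted ?f s) =
    rec_nat 0 (\<lambda>s T. if consistent ?f (set_decode (2 ^ s + T)) then 2 ^ s + T else T) s" for s
  proof (induction s)
    case (Suc s)
    have "set_encode (insert s (accepted ?f s)) = 2 ^ s + set_encode (accepted ?f s)"
      using accepted_subset[of ?f s] finite_accepted[of ?f s] by (intro set_encode_insert) auto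
    then show ?case
      using Suc finite_accepted[of ?f s] set_encode_inverse[of "insert s (accepted ?f s)"] by simp
  qed simp
  moreover have dec: "decidable_in halting_problem (\<lambda>n. consistent ?f (set_decode (a n)))"
    if "total_computable_in halting_problem a" for a
    using computable_comp[OF decidable_consistent[unfolded decidable_in_def] that]
    unfolding decidable_in_def .
  ultimately show ?thesis by (simp only:) (intro computable_intros dec)
qed

lemma computable_best_value:
  "total_computable_in halting_problem
     (\<lambda>n. best_value (prog_eval {} p) (fst (prod_decode n)) (snd (prod_decode n)))"
proof -
  let ?f = "prog_eval {} p"
  \<comment> \<open>Membership becomes a digit test on a computable code.\<close>
  have mem: "s \<in> accepted ?f (Suc s) \<longleftrightarrow> s \<in> set_decode (set_encode (accepted ?f (Suc s)))" for s
    by (simp only: set_encode_inverse[OF finite_accepted])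
  have "best_value ?f x s = rec_nat 0 (\<lambda>s v. if s \<in> accepted ?f (Suc s) \<and> request_point s = x \<and>
         fst (prod_decode v) * Suc (snd (prod_decode (request_value s)))
           \<le> fst (prod_decode (request_value s)) * Suc (snd (prod_decode v))
      then request_value s else v) s" for x s
    by (induction s) (simp_all del: accepted.simps)
  then show ?thesis
    unfolding mem request_point_def request_value_def
    by (simp only:) (intro computable_intros computable_comp[OF computable_set_encode_accepted])
qed

text \<open>\<open>rat_decode\<close> reads its numerator as a coded integer, and
  \<open>int_encode\<close> sends a natural number \<open>k\<close> to \<open>2 * k\<close>; hence
  the doubling.\<close>

lemma rat_computable_best_value:
  "rat_computable_in halting_problem (\<lambda>x s. fraction (best_value (prog_eval {} p) x s))"
proof -
  let ?b = "\<lambda>n. best_value (prog_eval {} p) (fst (prod_decode n)) (snd (prod_decode n))"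
  have "total_computable_in halting_problem
      (\<lambda>n. prod_encode (2 * fst (prod_decode (?b n)), snd (prod_decode (?b n))))"
    by (intro computable_intros computable_best_value)
  moreover have "int_decode (2 * k) = int k" for k
    using int_encode_inverse[of "int k"] by (simp add: int_encode_def sum_encode_def)
  then have "fraction c = rat_decode (prod_encode (2 * fst (prod_decode c), snd (prod_decode c)))" for c
    by (simp add: rat_decode_def fraction_def)
  ultimately show ?thesis unfolding rat_computable_in_def
    by (intro exI conjI) auto
qed

section \<open>The limit semimeasure and its comparison with the lower frequency\<close>

theorem theorem4:
  fixes f :: "nat \<Rightarrow> nat option"
  assumes "partial_computable f"
  shows "\<exists>\<mu> :: nat \<Rightarrow> real. semimeasure \<mu> \<and> lower_semicomputable_in halting_problem \<mu> \<and>
           (\<forall>x. lower_frequency f x \<le> ereal (\<mu> x))"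
proof -
  obtain p where f: "f = prog_eval {} p" using assms by (auto simp: partial_computable_in_def)
  define g where "g = (\<lambda>x s. real_of_rat (fraction (best_value f x s)))"
  have nonneg: "0 \<le> g x s" for x s by (simp add: g_def fraction_nonneg)
  have mono: "mono (g x)" for x
    using mono_fraction_best_value[of f x] by (simp add: g_def mono_def of_rat_less_eq)
  have sum_g: "(\<Sum>x<B. g x s) \<le> 1" for B s unfolding g_def by (rule sum_best_value_le_1)
  \<comment> \<open>One term is at most a partial sum of nonnegative terms; this bound makes the
    monotone sequence converge.\<close>
  have "g x s \<le> 1" for x s
    using member_le_sum[of x "{..<Suc x}" "\<lambda>x. g x s"] nonneg sum_g[of s "Suc x"] by force
  then have "\<exists>L. g x \<longlonglongrightarrow> L" for x
    using incseq_convergent[OF mono[of x]] by metis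
  then obtain \<mu> where lim: "g x \<longlonglongrightarrow> \<mu> x" for x by metis
  have \<mu>_ge: "g x s \<le> \<mu> x" for x s using incseq_le[OF mono lim] .
  have \<mu>_nonneg: "0 \<le> \<mu> x" for x using nonneg[of x 0] \<mu>_ge[of x 0] by linarith
  have "(\<Sum>x<B. \<mu> x) \<le> 1" for B
    by (rule LIMSEQ_le_const2[OF tendsto_sum[of "{..<B}" g \<mu>]]) (auto intro: lim sum_g)
  then have "semimeasure \<mu>"
    unfolding semimeasure_def using \<mu>_nonneg
    by (auto intro!: suminf_le_const summableI_nonneg_bounded[where x = 1])
  moreover have "lower_semicomputable_in halting_problem \<mu>"
    unfolding lower_semicomputable_in_def
    using rat_computable_best_value[of p] mono_fraction_best_value lim
    by (intro exI[of _ "\<lambda>x s. fraction (best_value f x s)"]) (auto simp: f g_def)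
  moreover have "lower_frequency f x \<le> ereal (\<mu> x)" for x
  proof (rule ccontr)
    assume "\<not> ?thesis"
    then have "ereal (\<mu> x) < lower_frequency f x" by simp
    then obtain c' where c': "\<mu> x < c'" "ereal c' < lower_frequency f x"
      using ereal_dense2 by (metis less_ereal.simps(1))
    \<comment> \<open>Requests carry rational values, so a rational is put between
      \<open>\<mu> x\<close> and \<open>c'\<close>; being positive, it has a code under
      \<open>fraction\<close>.\<close>
    obtain q where q: "\<mu> x < real_of_rat q" "real_of_rat q < c'" using of_rat_dense[OF c'(1)] by blast
    have "0 < q" using q(1) \<mu>_nonneg[of x] by (metis le_less_trans zero_less_of_rat_iff)
    obtain c where c: "fraction c = q"
    proof -
      obtain a b where ab: "q = Fract a b" "b > 0" by (cases q) auto
      then have "a > 0" using \<open>0 < q\<close> by (simp add: zero_less_Fract_iff)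
      with ab have "fraction (prod_encode (nat a, nat (b - 1))) = q"
        by (simp add: fraction_def Fract_of_int_quotient)
      then show ?thesis by (rule that)
    qed
    have "\<forall>\<^sub>F n in sequentially. ereal c' < ereal (real (card {i. i < n \<and> f i = Some x}) / real n)"
      using c'(2) unfolding lower_frequency_def by (rule less_LiminfD)
    then obtain N where N: "\<And>n. N \<le> n \<Longrightarrow> c' < real (occurrences f n x) / real n"
      by (auto simp: eventually_sequentially occurrences_def)
    \<comment> \<open>From \<open>N\<close> on, \<open>f\<close> itself satisfies this request, so
      it is accepted at its own stage and lifts \<open>g x\<close> to at least \<open>q\<close>,
      above its limit.\<close>
    define s where "s = prod_encode (N, prod_encode (x, c))"
    have s: "request_start s = N" "request_point s = x" "request_value s = c"
      by (simp_all add: s_def request_start_def request_point_def request_value_def)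
    have "real_of_rat q * real i \<le> real (occurrences f i x)" if "N \<le> i" for i
    proof (cases "i = 0")
      case False
      have "real_of_rat q * real i \<le> c' * real i" using q(2) by (intro mult_right_mono) auto
      also have "\<dots> < real (occurrences f i x)" using N[OF that] False by (simp add: field_simps)
      finally show ?thesis by simp
    qed simp
    then have "consistent f (insert s (accepted f s))"
      by (intro consistent_insert_satisfied consistent_accepted finite_accepted) (simp add: s c)
    then have "real_of_rat q \<le> g x (Suc s)"
      unfolding g_def fraction_best_value_Suc by (simp add: s c of_rat_less_eq)
    with \<mu>_ge[of x "Suc s"] q(1) show False by linarith
  qed
  ultimately show ?thesis by blast
qed

end
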